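(* Let $N\in\mathbb{N}$ and let $\mathbf{A}=(a_{ij})\in\mathbb{R}^{N\times N}$ satisfy $\mathbf{A}\neq \mathbf{0}$, $a_{ij}\ge 0$ for all $i\neq j$, $\mu_{\mathbf{A}}(0)=\gamma_{\mathbf{A}}(0)=k\geq 1$ (algebraic and geometric multiplicity of the eigenvalue $0$), and $\sigma(\mathbf{A})\subseteq\{z\in\mathbb{C}\mid \operatorname{Re}(z)\le 0\}$. Let $\mathbf{n}_1,\dots,\mathbf{n}_k$ be a basis of $\ker(\mathbf{A}^{\mathsf T})$. Let $\mathbf{y}^*$ be any steady state of $\mathbf{y}'=\mathbf{A}\mathbf{y}$, i.e. $\mathbf{y}^*\in\ker(\mathbf{A})$. Then for all $\Delta t>0$, $\mathbf{y}^*$ is a (Lyapunov) stable fixed point of the GeCo1 iteration $$\mathbf{y}^{n+1}=\mathbf{g}(\mathbf{y}^n)=(\mathbf{I}+\Phi(\Delta t)\mathbf{A})\mathbf{y}^n,\qquad \Phi(\Delta t)=\frac{1-e^{-\Delta t\operatorname{trace}(\mathbf{S}^-)}}{\operatorname{trace}(\mathbf{S}^-)},$$ and there exists a $\delta>0$ such that $\mathbf{n}_j^{\mathsf T}\mathbf{y}^0=\mathbf{n}_j^{\mathsf T}\mathbf{y}^*$ for $j=1,\dots,k$ together with $\|\mathbf{y}^0-\mathbf{y}^*\|<\delta$ imply $\lim_{n\to\infty}\mathbf{y}^n=\mathbf{y}^*$, for all $\Delta t>0$.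
   Context: $\mathbf{A}$ is split as $\mathbf{A}=\mathbf{S}^+-\mathbf{S}^-$ into production and destruction parts with $\mathbf{S}^+,\mathbf{S}^-\ge\mathbf{0}$ entrywise; here $\mathbf{S}^-$ is the diagonal matrix with diagonal entries $\max(0,-a_{ii})$, so $\operatorname{trace}(\mathbf{S}^-)=\sum_{i:\,a_{ii}<0}|a_{ii}|$, and under the stated hypotheses $\operatorname{trace}(\mathbf{S}^-)>0$. Lyapunov stability: a fixed point $\mathbf{y}^*=\mathbf{g}(\mathbf{y}^* )$ of $\mathbf{y}^{n+1}=\mathbf{g}(\mathbf{y}^n)$ is stable if for any $\epsilon>0$ there is $\delta>0$ such that $\|\mathbf{y}^0-\mathbf{y}^*\|<\delta$ implies $\|\mathbf{y}^n-\mathbf{y}^*\|<\epsilon$ for all $n\ge0$. $\|\cdot\|$ is an arbitrary norm on $\mathbb{R}^N$. *)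

theory Defs
  imports "Jordan_Normal_Form.Spectral_Radius" "Jordan_Normal_Form.Matrix_Kernel"
begin

definition alg_mult :: "'a :: field mat \<Rightarrow> 'a \<Rightarrow> nat" where
  "alg_mult A e = Polynomial.order e (char_poly A)"

text \<open>The matrix \<open>char_matrix A e\<close> is \<open>A - e I\<close>, so this is the dimension of the eigenspace.\<close>

definition geom_mult :: "'a :: field mat \<Rightarrow> 'a \<Rightarrow> nat" where
  "geom_mult A e = kernel_dim (char_matrix A e)"

definition is_vec_norm :: "nat \<Rightarrow> (real vec \<Rightarrow> real) \<Rightarrow> bool" where
  "is_vec_norm N nrm \<longleftrightarrow>
     (\<forall>x \<in> carrier_vec N. 0 \<le> nrm x) \<and>
     (\<forall>x \<in> carrier_vec N. nrm x = 0 \<longleftrightarrow> x = 0\<^sub>v N) \<and>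
     (\<forall>c. \<forall>x \<in> carrier_vec N. nrm (c \<cdot>\<^sub>v x) = \<bar>c\<bar> * nrm x) \<and>
     (\<forall>x \<in> carrier_vec N. \<forall>y \<in> carrier_vec N. nrm (x + y) \<le> nrm x + nrm y)"

definition mat_trace :: "'a :: comm_monoid_add mat \<Rightarrow> 'a" where
  "mat_trace A = (\<Sum>i<dim_row A. A $$ (i, i))"

text \<open>
  The destruction part \<open>S\<^sup>-\<close> of the splitting \<open>A = S\<^sup>+ - S\<^sup>-\<close> of a matrix with nonnegative
  off-diagonal entries.
\<close>

definition destruction_mat :: "real mat \<Rightarrow> real mat" where
  "destruction_mat A = mat_diag (dim_row A) (\<lambda>i. max 0 (- (A $$ (i, i))))"

definition geco1_Phi :: "real mat \<Rightarrow> real \<Rightarrow> real" where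
  "geco1_Phi A dt =
     (1 - exp (- (dt * mat_trace (destruction_mat A)))) / mat_trace (destruction_mat A)"

definition geco1_map :: "real mat \<Rightarrow> real \<Rightarrow> real vec \<Rightarrow> real vec" where
  "geco1_map A dt y = (1\<^sub>m (dim_row A) + geco1_Phi A dt \<cdot>\<^sub>m A) *\<^sub>v y"

definition lyapunov_stable_fixed_point ::
  "nat \<Rightarrow> (real vec \<Rightarrow> real) \<Rightarrow> (real vec \<Rightarrow> real vec) \<Rightarrow> real vec \<Rightarrow> bool" where
  "lyapunov_stable_fixed_point N nrm g ystar \<longleftrightarrow>
     ystar \<in> carrier_vec N \<and> g ystar = ystar \<and>
     (\<forall>\<epsilon>>0. \<exists>\<delta>>0. \<forall>y0 \<in> carrier_vec N. nrm (y0 - ystar) < \<delta> \<longrightarrow>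
        (\<forall>n. nrm ((g ^^ n) y0 - ystar) < \<epsilon>))"

end

theory Submission
  imports Defs
begin

text \<open>
  Write \<open>M = I + \<Phi> A\<close>. Since \<open>\<Phi> trace(S\<^sup>-) = 1 - d\<close> with \<open>d = exp (- \<Delta>t trace(S\<^sup>-)) > 0\<close>, the
  matrix \<open>B = M - d I\<close> is entrywise nonnegative, so its spectral radius is a real eigenvalue
  \<open>r\<close> of \<open>B\<close>. Then \<open>(r + d - 1) / \<Phi>\<close> is an eigenvalue of \<open>A\<close>, hence \<open>r \<le> 1 - d\<close>: the spectrum of \<open>M\<close>
  lies in a disc which meets the unit circle only at \<open>1\<close>. As the eigenvalue \<open>0\<close> of \<open>A\<close> is semisimple,
  there is a projection \<open>E\<close> onto the kernel of \<open>A\<close> with \<open>A E = E A = 0\<close>; the powers of \<open>M - E\<close> tend to \<open>0\<close>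
  and \<open>M\<^sup>k = E + (M - E)\<^sup>k\<close> for \<open>k > 0\<close>. So \<open>M\<^sup>k\<close> is bounded and tends to \<open>E\<close>, and \<open>E\<close> annihilates
  every vector that is orthogonal to the kernel of the transpose, because the rows of \<open>E\<close> lie in it.
\<close>

subsection \<open>The projection onto a semisimple kernel\<close>

text \<open>
  The characteristic matrix is a diagonal matrix with \<open>card S\<close> entries \<open>X\<close> times a matrix \<open>R\<close>, and up to
  signs of rows \<open>R\<close> takes the value \<open>A + F\<close> at \<open>X = 0\<close>.
\<close>

lemma det_add_diag_nonzero:
  fixes A :: "'a :: field mat"
  assumes A: "A \<in> carrier_mat n n" and S: "S \<subseteq> {..<n}"
    and zero: "\<And>i j. i \<in> S \<Longrightarrow> j < n \<Longrightarrow> A $$ (i, j) = 0"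
    and ord: "Polynomial.order 0 (char_poly A) = card S"
  shows "det (A + mat_diag n (\<lambda>i. if i \<in> S then 1 else 0)) \<noteq> 0"
proof -
  define F where "F = mat_diag n (\<lambda>i. if i \<in> S then 1 else 0 :: 'a)"
  define D where "D = mat_diag n (\<lambda>i. if i \<in> S then [:0, 1 :: 'a:] else 1)"
  define R where "R = mat n n (\<lambda>(i, j). if i \<in> S then if i = j then 1 else 0 else char_poly_matrix A $$ (i, j))"
  have F: "F \<in> carrier_mat n n" and D: "D \<in> carrier_mat n n" and R: "R \<in> carrier_mat n n"
    by (simp_all add: F_def D_def R_def)
  have "char_poly_matrix A = D * R"
    unfolding D_def mat_diag_mult_left[OF R]
    by (rule eq_matI) (use A S zero in \<open>auto simp: R_def char_poly_matrix_def\<close>)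
  then have cp: "char_poly A = det D * det R"
    unfolding char_poly_def using det_mult[OF D R] by simp
  have "det D = prod_list (diag_mat D)"
    by (rule det_upper_triangular[OF _ D]) (auto simp: D_def mat_diag_def)
  also have "\<dots> = (\<Prod>i<n. if i \<in> S then [:0, 1 :: 'a:] else 1)"
    unfolding diag_mat_def D_def
    by (subst prod.distinct_set_conv_list[symmetric]) (auto simp: mat_diag_def intro!: prod.cong)
  also have "\<dots> = [:0, 1:] ^ card S"
    using S by (simp add: prod.If_cases Int_absorb1 Int_absorb2)
  finally have detD: "det D = [:- 0, 1:] ^ card S" by simp
  \<comment> \<open>Orders of roots add up over products and \<open>det D\<close> already
    contributes \<open>card S\<close>, so \<open>ord\<close> leaves no root of \<open>det R\<close>
    at 0.\<close>
  have "char_poly A \<noteq> 0" using degree_monic_char_poly[OF A] by auto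
  then have "Polynomial.order 0 (char_poly A) = card S + Polynomial.order 0 (det R)"
    unfolding cp detD using order_mult[of "[:- 0, 1:] ^ card S" "det R"] order_power_n_n[of "0 :: 'a" "card S"]
    by metis
  with ord \<open>char_poly A \<noteq> 0\<close> have R0: "poly (det R) 0 \<noteq> 0"
    unfolding cp by (auto simp: order_root)
  have "mat_diag n (\<lambda>i. if i \<in> S then 1 else -1) * (A + F)
      = mat n n (\<lambda>(i, j). (if i \<in> S then 1 else -1) * (A + F) $$ (i, j))"
    by (rule mat_diag_mult_left) (use A F in auto)
  then have "poly (det R) 0 = det (mat_diag n (\<lambda>i. if i \<in> S then 1 else -1) * (A + F))"
    by (intro poly_det_cong[OF _ R])
       (use A F S zero in \<open>auto simp: R_def F_def mat_diag_def char_poly_matrix_def\<close>)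
  also have "\<dots> = det (mat_diag n (\<lambda>i. if i \<in> S then 1 else -1 :: 'a)) * det (A + F)"
    by (rule det_mult) (use A F in auto)
  finally show ?thesis using R0 by (auto simp: F_def)
qed

text \<open>
  By Gauss-Jordan elimination \<open>A\<close> is similar to a matrix \<open>A'\<close> with exactly \<open>kernel_dim A\<close> zero rows; let
  \<open>F\<close> be the coordinate projection onto these rows and \<open>G\<close> its conjugate. Then \<open>E = (A + G)\<^sup>-\<^sup>1 G\<close>.
\<close>

lemma ex_left_right_null_projection:
  fixes A :: "'a :: field mat"
  assumes A: "A \<in> carrier_mat n n" and ord: "Polynomial.order 0 (char_poly A) = kernel_dim A"
  shows "\<exists>E \<in> carrier_mat n n. \<exists>H \<in> carrier_mat n n.
    A * E = 0\<^sub>m n n \<and> E * A = 0\<^sub>m n n \<and> 1\<^sub>m n - E = H * A"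
proof -
  define C where "C = gauss_jordan_single A"
  note gj = gauss_jordan_single[OF A C_def[symmetric]]
  obtain P Q where C: "C = P * A" and P: "P \<in> carrier_mat n n" and Q: "Q \<in> carrier_mat n n"
    and PQ: "P * Q = 1\<^sub>m n" and QP: "Q * P = 1\<^sub>m n" using gj(4) by auto
  define S where "S = {i. i < n \<and> row C i = 0\<^sub>v n}"
  have "S \<subseteq> {..<n}" by (auto simp: S_def)
  have "kernel_dim A = n - length (pivot_positions C)"
    unfolding kernel_dim_code C_def using A by simp
  \<comment> \<open>In row echelon form the pivots correspond to the nonzero rows.\<close>
  also have "\<dots> = n - card {i. i < n \<and> row C i \<noteq> 0\<^sub>v n}"
    using find_base_vectors(5)[OF gj(3) gj(2)] by simp
  also have "{i. i < n \<and> row C i \<noteq> 0\<^sub>v n} = {..<n} - S"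
    by (auto simp: S_def)
  also have "n - card ({..<n} - S) = card S"
    using card_mono[of "{..<n}" S] \<open>S \<subseteq> {..<n}\<close> by (simp add: card_Diff_subset finite_subset)
  finally have kd: "kernel_dim A = card S" .
  define F where "F = mat_diag n (\<lambda>i. if i \<in> S then 1 else 0 :: 'a)"
  have F: "F \<in> carrier_mat n n" by (simp add: F_def)
  have FC: "F * C = 0\<^sub>m n n"
    unfolding F_def mat_diag_mult_left[OF gj(2)]
  proof (rule eq_matI)
    fix i j assume ij: "i < dim_row (0\<^sub>m n n :: 'a mat)" "j < dim_col (0\<^sub>m n n :: 'a mat)"
    have "i \<in> S \<Longrightarrow> C $$ (i, j) = 0"
      using ij gj(2) index_row(1)[of i C j] by (auto simp: S_def)
    with ij show "mat n n (\<lambda>(i, j). (if i \<in> S then 1 else 0) * C $$ (i, j)) $$ (i, j) = 0\<^sub>m n n $$ (i, j)"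
      by simp
  qed auto
  have FF: "F * F = F" by (simp add: F_def) (rule arg_cong[of _ _ "mat_diag n"], auto)
  \<comment> \<open>This is \<open>P * A * Q\<close>, a conjugate of \<open>A\<close>; multiplying
    from the right by \<open>Q\<close> keeps the zero rows of \<open>C\<close>.\<close>
  define A' where "A' = C * Q"
  have A': "A' \<in> carrier_mat n n" using gj(2) Q by (simp add: A'_def)
  have "similar_mat A' A"
    unfolding similar_mat_def using A A' P Q PQ QP C
    by (intro exI[of _ P] exI[of _ Q] similar_mat_witI[of P Q n]) (auto simp: A'_def)
  then have "char_poly A' = char_poly A" by (rule char_poly_similar)
  moreover have "A' $$ (i, j) = 0" if "i \<in> S" "j < n" for i j
    using that gj(2) Q by (simp add: A'_def S_def)
  ultimately have detK: "det (A' + F) \<noteq> 0"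
    unfolding F_def using ord kd A' by (intro det_add_diag_nonzero) (auto simp: S_def)
  define G where "G = Q * F * P"
  have G: "G \<in> carrier_mat n n" using P Q F by (simp add: G_def)
  have GA: "G * A = 0\<^sub>m n n"
  proof -
    have "G * A = Q * (F * C)" using P Q F A
      by (simp add: G_def C assoc_mult_mat[of _ n n _ n _ n])
    then show ?thesis using Q by (simp add: FC)
  qed
  have GG: "G * G = G"
  proof -
    have "G * G = Q * F * (P * Q) * (F * P)" unfolding G_def using P Q F
      by (smt (verit) assoc_mult_mat mult_carrier_mat)
    also have "\<dots> = Q * (F * F) * P" unfolding PQ using P Q F
      by (simp add: assoc_mult_mat[of _ n n _ n _ n])
    finally show ?thesis by (simp add: FF G_def)
  qed
  have AG: "A + G = Q * (A' + F) * P"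
  proof -
    have "Q * (A' + F) * P = Q * A' * P + Q * F * P"
      using P Q F A' by (simp add: mult_add_distrib_mat[of _ n n] add_mult_distrib_mat[of _ n n])
    also have "Q * A' * P = (Q * P) * A * (Q * P)" unfolding A'_def C using P Q A
      by (smt (verit) assoc_mult_mat mult_carrier_mat)
    finally show ?thesis using A by (simp add: QP G_def)
  qed
  have "det Q * det P = 1" using det_mult[OF Q P] by (simp add: QP)
  then have "det (A + G) \<noteq> 0"
    unfolding AG using detK P Q A' F by (auto simp: det_mult[of _ n])
  then obtain L where L: "L \<in> carrier_mat n n" and LAG: "L * (A + G) = 1\<^sub>m n" and AGL: "(A + G) * L = 1\<^sub>m n"
    using det_non_zero_imp_unit[of "A + G" n] A G unfolding Units_def ring_mat_def by auto
  \<comment> \<open>The aim is \<open>G * L = G\<close>. It yields \<open>G * E = G\<close>, and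
    comparison with \<open>(A + G) * E = G\<close> leaves \<open>A * E = 0\<close>.\<close>
  have "G = G * (A + G) * L"
    using A G L AGL by (simp add: assoc_mult_mat[of _ n n _ n _ n])
  also have "G * (A + G) = G" using A G by (simp add: mult_add_distrib_mat[of _ n n] GA GG)
  finally have GL: "G * L = G" by simp
  define E where "E = L * G"
  have E: "E \<in> carrier_mat n n" using L G by (simp add: E_def)
  have "(A + G) * E = G"
    unfolding E_def using AGL A G L assoc_mult_mat[of "A + G" n n L n G n] by simp
  moreover have "(A + G) * E = A * E + G * E"
    using A G E by (simp add: add_mult_distrib_mat[of _ n n])
  moreover have "G * E = G"
    unfolding E_def using G L GL GG assoc_mult_mat[of G n n L n G n] by simp
  ultimately have "A * E + G = G" by simp
  have AE: "A * E = 0\<^sub>m n n"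
  proof (rule eq_matI)
    fix i j assume "i < dim_row (0\<^sub>m n n :: 'a mat)" "j < dim_col (0\<^sub>m n n :: 'a mat)"
    with arg_cong[OF \<open>A * E + G = G\<close>, of "\<lambda>M. M $$ (i, j)"] A E G
    show "(A * E) $$ (i, j) = 0\<^sub>m n n $$ (i, j)" by simp
  qed (use A E in auto)
  have EA: "E * A = 0\<^sub>m n n" using A G L by (simp add: E_def GA)
  \<comment> \<open>Expanding \<open>L * (A + G) = 1\<close> shows that \<open>L\<close> itself is
    the witness for \<open>H\<close>.\<close>
  have "1\<^sub>m n = L * A + E"
    using LAG A G L by (simp add: E_def mult_add_distrib_mat[of _ n n])
  then have "1\<^sub>m n - E = L * A" using L A E
    by (simp) (rule eq_matI, auto)
  with E L AE EA show ?thesis by blast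
qed

subsection \<open>Powers and spectral radius\<close>

text \<open>By the Leibniz formula the determinant is a finite sum of finite products of entries, so
  entrywise limits suffice.\<close>

lemma tendsto_det:
  fixes M :: "'b \<Rightarrow> 'a :: real_normed_field mat"
  assumes M: "\<And>t. M t \<in> carrier_mat n n" and L: "L \<in> carrier_mat n n"
    and lim: "\<And>i j. i < n \<Longrightarrow> j < n \<Longrightarrow> ((\<lambda>t. M t $$ (i, j)) \<longlongrightarrow> L $$ (i, j)) F"
  shows "((\<lambda>t. det (M t)) \<longlongrightarrow> det L) F"
  unfolding det_def'[OF M] det_def'[OF L]
  by (intro tendsto_sum tendsto_mult tendsto_const tendsto_prod lim) (auto simp: permutes_in_image[of _ "{0..<n}", simplified atLeast0LessThan])

lemma tendsto_adj_mat:
  fixes M :: "'b \<Rightarrow> 'a :: real_normed_field mat"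
  assumes M: "\<And>t. M t \<in> carrier_mat n n" and L: "L \<in> carrier_mat n n"
    and lim: "\<And>i j. i < n \<Longrightarrow> j < n \<Longrightarrow> ((\<lambda>t. M t $$ (i, j)) \<longlongrightarrow> L $$ (i, j)) F"
    and ij: "i < n" "j < n"
  shows "((\<lambda>t. adj_mat (M t) $$ (i, j)) \<longlongrightarrow> adj_mat L $$ (i, j)) F"
proof -
  have "((\<lambda>t. det (mat_delete (M t) j i)) \<longlongrightarrow> det (mat_delete L j i)) F"
  proof (rule tendsto_det[where n = "n - 1"])
    fix a b assume ab: "a < n - 1" "b < n - 1"
    \<comment> \<open>The adjugate is transposed, so row \<open>j\<close> and column
      \<open>i\<close> are deleted; indices from the deleted one on shift by one.\<close>
    have eq: "mat_delete X j i $$ (a, b) = X $$ (if a < j then a else Suc a, if b < i then b else Suc b)"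
      if "X \<in> carrier_mat n n" for X :: "'a mat" using that ab by (simp add: mat_delete_def)
    show "((\<lambda>t. mat_delete (M t) j i $$ (a, b)) \<longlongrightarrow> mat_delete L j i $$ (a, b)) F"
      unfolding eq[OF M] eq[OF L] using ab by (intro lim) auto
  qed (use M L in \<open>auto simp: mat_delete_def carrier_matD[OF M]\<close>)
  then show ?thesis
    using M L ij by (auto simp: adj_mat_def cofactor_def carrier_matD[OF M] intro!: tendsto_mult)
qed

lemma smult_mat_vec:
  fixes A :: "'a :: comm_ring_1 mat"
  assumes "A \<in> carrier_mat nr nc" "v \<in> carrier_vec nc"
  shows "(c \<cdot>\<^sub>m A) *\<^sub>v v = c \<cdot>\<^sub>v (A *\<^sub>v v)"
  by (rule eq_vecI) (use assms in auto)

lemma pow_smult_mat: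
  fixes A :: "'a :: comm_ring_1 mat"
  assumes A: "A \<in> carrier_mat n n"
  shows "(c \<cdot>\<^sub>m A) ^\<^sub>m k = c ^ k \<cdot>\<^sub>m (A ^\<^sub>m k)"
proof (induction k)
  case (Suc k)
  have "A ^\<^sub>m k \<in> carrier_mat n n" using A by simp
  then show ?case using Suc A
    by (simp add: mult_smult_distrib[of _ n n] mult_smult_assoc_mat[of _ n n]) (rule eq_matI, auto)
qed (use A in \<open>auto intro!: eq_matI\<close>)

text \<open>Division by \<open>s\<close> moves the spectrum strictly inside the unit disc, and a
  matrix with spectral radius below 1 has bounded powers.\<close>

lemma pow_entries_geometric_bound:
  fixes A :: "complex mat"
  assumes A: "A \<in> carrier_mat n n" and s: "0 < s"
    and ev: "\<And>\<mu>. eigenvalue A \<mu> \<Longrightarrow> cmod \<mu> < s"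
  shows "\<exists>c. \<forall>k. \<forall>i<n. \<forall>j<n. cmod ((A ^\<^sub>m k) $$ (i, j)) \<le> c * s ^ k"
proof (cases "n = 0")
  case False
  define B where "B = complex_of_real (1 / s) \<cdot>\<^sub>m A"
  have B: "B \<in> carrier_mat n n" using A by (simp add: B_def)
  have "cmod \<mu> < 1" if ev_B: "eigenvalue B \<mu>" for \<mu>
  proof -
    obtain v where v: "v \<in> carrier_vec n" "v \<noteq> 0\<^sub>v n" "B *\<^sub>v v = \<mu> \<cdot>\<^sub>v v"
      using ev_B carrier_matD[OF B] unfolding eigenvalue_def eigenvector_def by auto
    have "A *\<^sub>v v = (complex_of_real s * complex_of_real (1/s)) \<cdot>\<^sub>v (A *\<^sub>v v)"
      using s by simp
    also have "\<dots> = complex_of_real s \<cdot>\<^sub>v (B *\<^sub>v v)"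
      using A v(1) by (simp add: B_def smult_smult_assoc smult_mat_vec[OF A])
    finally have "A *\<^sub>v v = (s * \<mu>) \<cdot>\<^sub>v v" using v by (simp add: smult_smult_assoc)
    then have "cmod (s * \<mu>) < s" using v A by (intro ev) (auto simp: eigenvalue_def eigenvector_def)
    with s show ?thesis by (simp add: norm_mult)
  qed
  then have "spectral_radius B < 1"
    using spectral_radius_mem_max(1)[OF B] False by (auto simp: spectrum_def)
  then obtain c where c: "\<And>k. norm_bound (B ^\<^sub>m k) c"
    using spectral_radius_jnf_norm_bound_less_1_upper_triangular[OF B] by blast
  have "cmod ((A ^\<^sub>m k) $$ (i, j)) \<le> c * s ^ k" if ij: "i < n" "j < n" for k i j
  proof -
    have Ak: "A ^\<^sub>m k \<in> carrier_mat n n" "B ^\<^sub>m k \<in> carrier_mat n n" using A B by simp_all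
    have "cmod ((B ^\<^sub>m k) $$ (i, j)) \<le> c" using c[of k] ij Ak(2) unfolding norm_bound_def
      by (metis carrier_matD)
    then show ?thesis using Ak ij s A
      by (simp add: B_def pow_smult_mat norm_mult norm_divide norm_power field_simps)
  qed
  then show ?thesis by blast
qed simp

text \<open>The spectrum is finite, so some \<open>s < t\<close> still exceeds all moduli and the
  quotients decay like \<open>(s / t) ^ k\<close>.\<close>

lemma pow_entries_tendsto_0:
  fixes A :: "complex mat"
  assumes A: "A \<in> carrier_mat n n" and t: "0 < t"
    and ev: "\<And>\<mu>. eigenvalue A \<mu> \<Longrightarrow> cmod \<mu> < t"
    and ij: "i < n" "j < n"
  shows "(\<lambda>k. (A ^\<^sub>m k) $$ (i, j) / complex_of_real (t ^ k)) \<longlonglongrightarrow> 0"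
proof -
  obtain s where s: "0 < s" "s < t" and less: "\<And>\<mu>. eigenvalue A \<mu> \<Longrightarrow> cmod \<mu> < s"
  proof -
    \<comment> \<open>The inserted 0 keeps \<open>Max\<close> defined without a nonemptiness
      argument and makes the midpoint of \<open>r\<close> and \<open>t\<close> positive.\<close>
    define r where "r = Max (insert 0 (cmod ` spectrum A))"
    have fin: "finite (insert 0 (cmod ` spectrum A))" using card_finite_spectrum(1)[OF A] by simp
    have "r < t" "0 \<le> r" unfolding r_def
      using fin ev t by (auto simp: spectrum_def)
    moreover have "cmod \<mu> \<le> r" if "eigenvalue A \<mu>" for \<mu>
      unfolding r_def using fin that by (intro Max_ge) (auto simp: spectrum_def)
    ultimately show thesis by (intro that[of "(r + t) / 2"]) force+
  qed
  obtain c where c: "\<And>k. cmod ((A ^\<^sub>m k) $$ (i, j)) \<le> c * s ^ k"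
    using pow_entries_geometric_bound[OF A s(1) less] ij by blast
  have "(\<lambda>k. c * (s / t) ^ k) \<longlonglongrightarrow> 0"
    using s by (intro tendsto_mult_right_zero LIMSEQ_realpow_zero) auto
  moreover have "cmod ((A ^\<^sub>m k) $$ (i, j) / complex_of_real (t ^ k)) \<le> norm (c * (s / t) ^ k) * 1" for k
  proof -
    have "cmod ((A ^\<^sub>m k) $$ (i, j) / complex_of_real (t ^ k)) = cmod ((A ^\<^sub>m k) $$ (i, j)) / t ^ k"
      using t by (simp add: norm_divide norm_power)
    also have "\<dots> \<le> c * s ^ k / t ^ k"
      using c[of k] t by (intro divide_right_mono) auto
    also have "\<dots> = c * (s / t) ^ k" by (simp add: power_divide)
    also have "\<dots> \<le> norm (c * (s / t) ^ k) * 1" by simp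
    finally show ?thesis .
  qed
  ultimately show ?thesis by (rule tendsto_0_le[OF _ always_eventually, rule_format])
qed

lemma real_pow_entries_tendsto_0:
  fixes A :: "real mat"
  assumes A: "A \<in> carrier_mat n n" and t: "0 < t"
    and ev: "\<And>\<mu>. eigenvalue (map_mat complex_of_real A) \<mu> \<Longrightarrow> cmod \<mu> < t"
    and ij: "i < n" "j < n"
  shows "(\<lambda>k. (A ^\<^sub>m k) $$ (i, j) / t ^ k) \<longlonglongrightarrow> 0"
proof -
  have Ak: "A ^\<^sub>m k \<in> carrier_mat n n" for k using A by simp
  have "map_mat complex_of_real A \<in> carrier_mat n n" using A by simp
  from pow_entries_tendsto_0[OF this t ev ij]
  have "(\<lambda>k. complex_of_real ((A ^\<^sub>m k) $$ (i, j) / t ^ k)) \<longlonglongrightarrow> complex_of_real 0"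
    using ij carrier_matD[OF Ak] by (simp flip: of_real_hom.mat_hom_pow[OF A])
  then show ?thesis by (simp only: tendsto_of_real_iff)
qed

subsection \<open>Dominant eigenvalues of nonnegative matrices\<close>

lemma nonneg_mat_pow:
  fixes B :: "real mat"
  assumes B: "B \<in> carrier_mat n n" and nonneg: "\<And>i j. i < n \<Longrightarrow> j < n \<Longrightarrow> 0 \<le> B $$ (i, j)"
  shows "i < n \<Longrightarrow> j < n \<Longrightarrow> 0 \<le> (B ^\<^sub>m k) $$ (i, j)"
proof (induction k arbitrary: i j)
  case (Suc k)
  have "B ^\<^sub>m k \<in> carrier_mat n n" using B by simp
  then have "(B ^\<^sub>m Suc k) $$ (i, j) = (\<Sum>l<n. (B ^\<^sub>m k) $$ (i, l) * B $$ (l, j))"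
    using B Suc.prems by (simp add: scalar_prod_def atLeast0LessThan)
  then show ?case using Suc nonneg by (auto intro!: sum_nonneg mult_nonneg_nonneg)
qed (use B in auto)

text \<open>Nonnegative powers preserve inequalities, so iteration gives
  \<open>B^k z <= t^k z\<close> coordinatewise. After division by \<open>t^k\<close> the left side
  tends to 0, because \<open>t\<close> exceeds the modulus of every eigenvalue.\<close>

lemma subinvariant_vec_nonneg:
  fixes B :: "real mat"
  assumes B: "B \<in> carrier_mat n n" and nonneg: "\<And>i j. i < n \<Longrightarrow> j < n \<Longrightarrow> 0 \<le> B $$ (i, j)"
    and t: "0 < t" and ev: "\<And>\<mu>. eigenvalue (map_mat complex_of_real B) \<mu> \<Longrightarrow> cmod \<mu> < t"
    and z: "z \<in> carrier_vec n" and le: "\<And>i. i < n \<Longrightarrow> (B *\<^sub>v z) $ i \<le> t * z $ i"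
    and i: "i < n"
  shows "0 \<le> z $ i"
proof -
  have Bk: "B ^\<^sub>m k \<in> carrier_mat n n" for k using B by simp
  have row_sum: "(M *\<^sub>v y) $ i = (\<Sum>j<n. M $$ (i, j) * y $ j)"
    if "M \<in> carrier_mat n n" "y \<in> carrier_vec n" for M and y :: "real vec"
    using that i by (simp add: scalar_prod_def atLeast0LessThan)
  have pow_le: "(B ^\<^sub>m k *\<^sub>v z) $ i \<le> t ^ k * z $ i" for k
  proof (induction k)
    case (Suc k)
    have Bz: "B *\<^sub>v z \<in> carrier_vec n" using B z by simp
    have "(B ^\<^sub>m Suc k *\<^sub>v z) $ i = (B ^\<^sub>m k *\<^sub>v (B *\<^sub>v z)) $ i"
      using assoc_mult_mat_vec[OF Bk B z] by simp
    also have "\<dots> \<le> (\<Sum>j<n. (B ^\<^sub>m k) $$ (i, j) * (t * z $ j))"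
      unfolding row_sum[OF Bk Bz]
      using nonneg_mat_pow[of B n] B nonneg i by (intro sum_mono mult_left_mono le) auto
    also have "\<dots> = t * (B ^\<^sub>m k *\<^sub>v z) $ i"
      unfolding row_sum[OF Bk z] by (simp add: sum_distrib_left ac_simps)
    also have "\<dots> \<le> t * (t ^ k * z $ i)" using Suc t by (intro mult_left_mono) auto
    finally show ?case by (simp add: ac_simps)
  qed (use B z i in simp)
  have "(\<lambda>k. (B ^\<^sub>m k) $$ (i, j) / t ^ k) \<longlonglongrightarrow> 0" if "j < n" for j
    using real_pow_entries_tendsto_0[OF B t ev i that] .
  then have "(\<lambda>k. \<Sum>j<n. (B ^\<^sub>m k) $$ (i, j) / t ^ k * z $ j) \<longlonglongrightarrow> (\<Sum>j<n. 0 * z $ j)"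
    by (intro tendsto_sum tendsto_mult tendsto_const) auto
  moreover have "(\<Sum>j<n. (B ^\<^sub>m k) $$ (i, j) / t ^ k * z $ j) \<le> z $ i" for k
  proof -
    have "(\<Sum>j<n. (B ^\<^sub>m k) $$ (i, j) / t ^ k * z $ j) = (B ^\<^sub>m k *\<^sub>v z) $ i / t ^ k"
      unfolding row_sum[OF Bk z] by (simp add: sum_divide_distrib)
    also have "\<dots> \<le> t ^ k * z $ i / t ^ k" using pow_le[of k] t by (intro divide_right_mono) auto
    finally show ?thesis using t by simp
  qed
  ultimately show ?thesis
    using LIMSEQ_le_const2[of _ "\<Sum>j<n. 0 * z $ j" "z $ i"] by auto
qed

text \<open>
  For an eigenvector \<open>v\<close> of maximal modulus \<open>r\<close> the vector \<open>x = |v|\<close> satisfies \<open>B x \<ge> r x\<close>, so for \<open>t > r\<close> the solution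
  \<open>y\<close> of \<open>(t I - B) y = x\<close> satisfies \<open>x \<le> (t - r) y\<close>. Were \<open>r I - B\<close> regular, \<open>y\<close> would stay bounded
  as \<open>t\<close> decreases to \<open>r\<close>, forcing \<open>x = 0\<close>.
\<close>

lemma nonneg_mat_dominant_eigenvalue:
  fixes B :: "real mat"
  assumes B: "B \<in> carrier_mat n n" and n: "0 < n"
    and nonneg: "\<And>i j. i < n \<Longrightarrow> j < n \<Longrightarrow> 0 \<le> B $$ (i, j)"
  shows "\<exists>r. eigenvalue B r \<and> (\<forall>\<mu>. eigenvalue (map_mat complex_of_real B) \<mu> \<longrightarrow> cmod \<mu> \<le> r)"
proof -
  let ?Bc = "map_mat complex_of_real B"
  have Bc: "?Bc \<in> carrier_mat n n" using B by simp
  define r where "r = spectral_radius ?Bc"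
  have max: "cmod \<mu> \<le> r" if "eigenvalue ?Bc \<mu>" for \<mu>
    using spectral_radius_mem_max(2)[OF Bc n] that by (auto simp: r_def spectrum_def)
  obtain \<mu> where \<mu>: "eigenvalue ?Bc \<mu>" "cmod \<mu> = r"
    using spectral_radius_mem_max(1)[OF Bc n] by (auto simp: r_def spectrum_def)
  then obtain v where v: "v \<in> carrier_vec n" "v \<noteq> 0\<^sub>v n" "?Bc *\<^sub>v v = \<mu> \<cdot>\<^sub>v v"
    using carrier_matD[OF B] unfolding eigenvalue_def eigenvector_def by auto
  define x where "x = vec n (\<lambda>i. cmod (v $ i))"
  have x: "x \<in> carrier_vec n" by (simp add: x_def)
  have Bx: "r * x $ i \<le> (B *\<^sub>v x) $ i" if i: "i < n" for i
  proof -
    have "r * x $ i = cmod ((?Bc *\<^sub>v v) $ i)"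
      unfolding v(3) using i v(1) \<mu>(2) by (simp add: x_def norm_mult)
    also have "(?Bc *\<^sub>v v) $ i = (\<Sum>j<n. complex_of_real (B $$ (i, j)) * v $ j)"
      using i v(1) B by (simp add: scalar_prod_def atLeast0LessThan)
    also have "cmod \<dots> \<le> (\<Sum>j<n. cmod (complex_of_real (B $$ (i, j)) * v $ j))"
      by (rule norm_sum)
    also have "\<dots> = (B *\<^sub>v x) $ i"
      using i B nonneg by (simp add: scalar_prod_def atLeast0LessThan x_def norm_mult)
    finally show ?thesis .
  qed
  have r0: "0 \<le> r" using \<mu>(2) by auto
  define C where "C t = char_matrix B t" for t
  have C: "C t \<in> carrier_mat n n" for t using B by (simp add: C_def)
  have Cw: "(C t *\<^sub>v w) $ i = (B *\<^sub>v w) $ i - t * w $ i" if "i < n" "w \<in> carrier_vec n" for t w i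
    using that B unfolding C_def char_matrix_def
    by (subst add_mult_distrib_mat_vec[of _ n n]) (auto simp: smult_mat_vec[of _ n n])
  \<comment> \<open>The denominator is cleared so that both sides have limits as \<open>t\<close>
    decreases to \<open>r\<close>, whether or not \<open>det (C r)\<close> vanishes.\<close>
  have bound: "\<bar>det (C t)\<bar> * x $ i \<le> (t - r) * \<bar>(adj_mat (C t) *\<^sub>v x) $ i\<bar>"
    if t: "r < t" and i: "i < n" for t i
  proof -
    have det: "det (C t) \<noteq> 0"
    proof
      assume "det (C t) = 0"
      then have "eigenvalue B t" using eigenvalue_det[OF B] by (simp add: C_def)
      then have "eigenvalue ?Bc (complex_of_real t)" by (rule of_real_hom.eigenvalue_hom[OF B])
      from max[OF this] t r0 show False by simp
    qed
    \<comment> \<open>Since \<open>C t\<close> is \<open>B - t I\<close>, the minus sign makes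
      \<open>y\<close> the solution of \<open>(t I - B) y = x\<close>.\<close>
    define y where "y = (- 1 / det (C t)) \<cdot>\<^sub>v (adj_mat (C t) *\<^sub>v x)"
    have adj: "adj_mat (C t) *\<^sub>v x \<in> carrier_vec n"
      using adj_mat(1)[OF C[of t]] x by (rule mult_mat_vec_carrier)
    then have y: "y \<in> carrier_vec n" by (simp add: y_def)
    have "C t *\<^sub>v (adj_mat (C t) *\<^sub>v x) = det (C t) \<cdot>\<^sub>v x"
      using assoc_mult_mat_vec[OF C adj_mat(1)[OF C] x, symmetric] adj_mat(2)[OF C] x
      by (simp add: smult_mat_vec[of _ n n])
    then have Cy: "C t *\<^sub>v y = - x"
      using C[of t] adj x det by (simp add: y_def mult_mat_vec smult_smult_assoc) (rule eq_vecI, auto)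
    \<comment> \<open>Here \<open>(t I - B) z = (t - r) x - (t I - B) x = B x - r x\<close>, which
      is nonnegative; hence \<open>B z <= t z\<close>, and \<open>z\<close> turns out
      nonnegative.\<close>
    define z where "z = (t - r) \<cdot>\<^sub>v y - x"
    have z: "z \<in> carrier_vec n" using x y by (simp add: z_def)
    have "C t *\<^sub>v z = (t - r) \<cdot>\<^sub>v (- x) - C t *\<^sub>v x"
      unfolding z_def using C[of t] x y Cy by (simp add: mult_minus_distrib_mat_vec mult_mat_vec)
    then have Cz: "(C t *\<^sub>v z) $ j = - (t - r) * x $ j - (C t *\<^sub>v x) $ j" if "j < n" for j
      using that C[of t] x by (simp add: algebra_simps)
    have "(B *\<^sub>v z) $ j \<le> t * z $ j" if j: "j < n" for j
      using Cz[OF j] Cw[OF j z, of t] Cw[OF j x, of t] Bx[OF j] by (simp add: algebra_simps)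
    moreover have "cmod \<mu> < t" if "eigenvalue ?Bc \<mu>" for \<mu> using max[OF that] t by simp
    ultimately have "0 \<le> z $ i"
      using subinvariant_vec_nonneg[of B n t z i] B nonneg t r0 z i by simp
    then have "x $ i \<le> (t - r) * y $ i" using i x y by (simp add: z_def)
    also have "\<dots> \<le> (t - r) * (\<bar>(adj_mat (C t) *\<^sub>v x) $ i\<bar> / \<bar>det (C t)\<bar>)"
    proof (rule mult_left_mono)
      have "y $ i \<le> \<bar>y $ i\<bar>" by simp
      also have "\<dots> = \<bar>(adj_mat (C t) *\<^sub>v x) $ i\<bar> / \<bar>det (C t)\<bar>"
        using i carrier_vecD[OF adj] by (simp add: y_def abs_mult del: index_mult_mat_vec)
      finally show "y $ i \<le> \<bar>(adj_mat (C t) *\<^sub>v x) $ i\<bar> / \<bar>det (C t)\<bar>" .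
    qed (use t in simp)
    finally show ?thesis using det by (simp add: field_simps)
  qed
  \<comment> \<open>One coordinate with \<open>x $ i > 0\<close> is enough: in the limit of
    \<open>bound\<close> the factor \<open>t - r\<close> vanishes, which forces
    \<open>det (C r) = 0\<close>.\<close>
  obtain i where i: "i < n" "v $ i \<noteq> 0" using v(1,2) by force
  have limC: "((\<lambda>t. C t $$ (a, b)) \<longlongrightarrow> C r $$ (a, b)) (at_right r)" if "a < n" "b < n" for a b
    using that B by (auto simp: C_def char_matrix_def intro!: tendsto_intros)
  have "((\<lambda>t. \<Sum>j<n. adj_mat (C t) $$ (i, j) * x $ j) \<longlongrightarrow> (\<Sum>j<n. adj_mat (C r) $$ (i, j) * x $ j)) (at_right r)"
    using i by (intro tendsto_intros tendsto_adj_mat[OF C C] limC) auto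
  moreover have "(adj_mat (C t) *\<^sub>v x) $ i = (\<Sum>j<n. adj_mat (C t) $$ (i, j) * x $ j)" for t
    using i adj_mat(1)[OF C[of t]] x by (simp add: scalar_prod_def atLeast0LessThan)
  ultimately have "((\<lambda>t. (t - r) * \<bar>(adj_mat (C t) *\<^sub>v x) $ i\<bar>) \<longlongrightarrow> (r - r) * \<bar>(adj_mat (C r) *\<^sub>v x) $ i\<bar>) (at_right r)"
    by (intro tendsto_intros) simp
  moreover have "((\<lambda>t. \<bar>det (C t)\<bar> * x $ i) \<longlongrightarrow> \<bar>det (C r)\<bar> * x $ i) (at_right r)"
    by (intro tendsto_intros tendsto_det[OF C C] limC)
  moreover have "\<forall>\<^sub>F t in at_right r. \<bar>det (C t)\<bar> * x $ i \<le> (t - r) * \<bar>(adj_mat (C t) *\<^sub>v x) $ i\<bar>"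
    using bound[OF _ i(1)] by (auto simp: eventually_at_filter)
  ultimately have "\<bar>det (C r)\<bar> * x $ i \<le> (r - r) * \<bar>(adj_mat (C r) *\<^sub>v x) $ i\<bar>"
    by (intro tendsto_le[of "at_right r"]) auto
  moreover have "0 < x $ i" using i by (simp add: x_def)
  ultimately have "det (C r) = 0" by (simp add: mult_le_0_iff)
  then have "eigenvalue B r" using eigenvalue_det[OF B] by (simp add: C_def)
  with max show ?thesis by blast
qed

subsection \<open>Powers of affine images of Metzler matrices\<close>

text \<open>Carries spectral information between \<open>A\<close> and the matrices
  \<open>I + a A\<close> and \<open>(1 - d) I + a A\<close>.\<close>

lemma eigenvector_affine_iff:
  fixes A :: "'a :: field mat"
  assumes A: "A \<in> carrier_mat n n" and a: "a \<noteq> 0"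
  shows "eigenvector (c \<cdot>\<^sub>m 1\<^sub>m n + a \<cdot>\<^sub>m A) v (c + a * l) \<longleftrightarrow> eigenvector A v l"
proof (cases "v \<in> carrier_vec n")
  case v: True
  have "(c \<cdot>\<^sub>m 1\<^sub>m n + a \<cdot>\<^sub>m A) *\<^sub>v v = c \<cdot>\<^sub>v v + a \<cdot>\<^sub>v (A *\<^sub>v v)"
    using A v by (simp add: add_mult_distrib_mat_vec[of _ n n] smult_mat_vec[of _ n n])
  moreover have "c \<cdot>\<^sub>v v + a \<cdot>\<^sub>v (A *\<^sub>v v) = (c + a * l) \<cdot>\<^sub>v v \<longleftrightarrow> A *\<^sub>v v = l \<cdot>\<^sub>v v" (is "?L \<longleftrightarrow> ?R")
  proof
    assume eq: ?L
    show ?R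
    proof (rule eq_vecI)
      fix i assume i: "i < dim_vec (l \<cdot>\<^sub>v v)"
      have "(c \<cdot>\<^sub>v v + a \<cdot>\<^sub>v (A *\<^sub>v v)) $ i = ((c + a * l) \<cdot>\<^sub>v v) $ i" unfolding eq ..
      then have "a * (A *\<^sub>v v) $ i = a * (l * v $ i)" using i v A by (simp add: algebra_simps del: index_mult_mat_vec)
      then show "(A *\<^sub>v v) $ i = (l \<cdot>\<^sub>v v) $ i" using a i v by (simp del: index_mult_mat_vec)
    qed (use v A in auto)
  next
    assume ?R
    then show ?L by (simp add: smult_smult_assoc add_smult_distrib_vec)
  qed
  ultimately show ?thesis using A v by (simp add: eigenvector_def)
next
  case False
  then show ?thesis using A by (auto simp: eigenvector_def)
qed

lemma eigenvalue_affine_iff: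
  fixes A :: "'a :: field mat"
  assumes "A \<in> carrier_mat n n" "a \<noteq> 0"
  shows "eigenvalue (c \<cdot>\<^sub>m 1\<^sub>m n + a \<cdot>\<^sub>m A) (c + a * l) \<longleftrightarrow> eigenvalue A l"
  using eigenvector_affine_iff[OF assms] by (simp add: eigenvalue_def)

text \<open>The disc of radius \<open>1 - d\<close> about \<open>d\<close> touches the unit circle
  from inside at 1. The triangle inequality gives modulus 1, and comparing squared distances then
  gives \<open>Re z >= 1\<close>.\<close>

lemma unit_circle_tangent:
  assumes d: "0 < d" and "cmod (z - of_real d) \<le> 1 - d" "1 \<le> cmod z"
  shows "z = 1"
proof -
  have "cmod z \<le> cmod (z - of_real d) + cmod (of_real d)"
    using norm_triangle_ineq[of "z - of_real d" "of_real d"] by simp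
  then have 1: "cmod z = 1" using assms by simp
  have "(cmod (z - of_real d))\<^sup>2 \<le> (1 - d)\<^sup>2" using assms by (intro power_mono) auto
  moreover have sq: "(Re z)\<^sup>2 + (Im z)\<^sup>2 = 1" using 1 by (simp add: cmod_def)
  moreover have "(cmod (z - of_real d))\<^sup>2 = (Re z - d)\<^sup>2 + (Im z)\<^sup>2" by (simp add: cmod_power2)
  ultimately have "d * 1 \<le> d * Re z"
    by (simp add: power2_eq_square algebra_simps)
  then have "1 \<le> Re z" using d by simp
  moreover from this have "1\<^sup>2 \<le> (Re z)\<^sup>2" by (intro power_mono) auto
  moreover have "Re z \<le> 1" using complex_Re_le_cmod[of z] 1 by simp
  ultimately show ?thesis using sq by (simp add: complex_eq_iff)
qed

text \<open>An eigenvector \<open>v\<close> of \<open>M - E\<close> for \<open>\<mu>\<close> of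
  modulus at least 1 is killed by \<open>E\<close>, hence is an eigenvector of \<open>M\<close>.
  Tangency forces \<open>\<mu> = 1\<close>, so \<open>A v = 0\<close> and
  \<open>v = E v + H A v = 0\<close>. The number \<open>d\<close> bounds the diagonal of
  \<open>M\<close> from below, which makes \<open>M - d I\<close> nonnegative.\<close>

lemma metzler_affine_pow_tendsto:
  fixes A E H :: "real mat"
  assumes A: "A \<in> carrier_mat n n"
    and off_diag: "\<And>i j. i < n \<Longrightarrow> j < n \<Longrightarrow> i \<noteq> j \<Longrightarrow> 0 \<le> A $$ (i, j)"
    and spec: "\<And>l. eigenvalue (map_mat complex_of_real A) l \<Longrightarrow> Re l \<le> 0"
    and E: "E \<in> carrier_mat n n" and H: "H \<in> carrier_mat n n"
    and AE: "A * E = 0\<^sub>m n n" and EA: "E * A = 0\<^sub>m n n" and EH: "1\<^sub>m n - E = H * A"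
    and a: "0 < a" and d: "0 < d" and diag: "\<And>i. i < n \<Longrightarrow> d \<le> 1 + a * A $$ (i, i)"
    and ij: "i < n" "j < n"
  shows "(\<lambda>k. ((1\<^sub>m n + a \<cdot>\<^sub>m A) ^\<^sub>m k) $$ (i, j)) \<longlonglongrightarrow> E $$ (i, j)"
proof -
  define M where "M = 1\<^sub>m n + a \<cdot>\<^sub>m A"
  define X where "X = M - E"
  define B where "B = (1 - d) \<cdot>\<^sub>m 1\<^sub>m n + a \<cdot>\<^sub>m A"
  have carr: "M \<in> carrier_mat n n" "X \<in> carrier_mat n n" "B \<in> carrier_mat n n"
    using A E by (auto simp: M_def X_def B_def intro!: minus_carrier_mat)
  have ME: "M * E = E"
    unfolding M_def using A E AE
    by (simp add: add_mult_distrib_mat[of _ n n] mult_smult_assoc_mat[of _ n n])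
  have EM: "E * M = E"
    unfolding M_def using A E EA
    by (simp add: mult_add_distrib_mat[of _ n n _ n] mult_smult_distrib[of _ n n])
  have EE: "E * E = E"
  proof -
    \<comment> \<open>Idempotence of \<open>E\<close> comes from
      \<open>(1 - E) E = H A E = 0\<close>.\<close>
    have "0\<^sub>m n n = H * A * E" using A E H AE by (simp add: assoc_mult_mat[of _ n n _ n _ n])
    also have "\<dots> = E - E * E" unfolding EH[symmetric] using E by (simp add: minus_mult_distrib_mat[of _ n n])
    finally have eq: "E - E * E = 0\<^sub>m n n" ..
    show ?thesis
    proof (rule eq_matI)
      fix p q assume "p < dim_row E" "q < dim_col E"
      then show "(E * E) $$ (p, q) = E $$ (p, q)"
        using arg_cong[OF eq, of "\<lambda>Y. Y $$ (p, q)"] E by simp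
    qed (use E in auto)
  qed
  have EX: "E * X = 0\<^sub>m n n"
    unfolding X_def using carr E by (simp add: mult_minus_distrib_mat[of _ n n] EM EE)
  have MkE: "M ^\<^sub>m k * E = E" for k
  proof (induction k)
    case (Suc k)
    then show ?case using carr E ME assoc_mult_mat[of "M ^\<^sub>m k" n n M n E n] by simp
  qed (use E carr in simp)
  \<comment> \<open>The exponent starts at 1: the zeroth powers of \<open>X\<close> and
    \<open>M\<close> are both the identity, so the formula fails there unless
    \<open>E = 0\<close>.\<close>
  have Xk: "X ^\<^sub>m Suc k = M ^\<^sub>m Suc k - E" for k
  proof (induction k)
    case 0
    then show ?case using carr E by (simp add: X_def)
  next
    case (Suc k)
    have Mk: "M ^\<^sub>m Suc k \<in> carrier_mat n n" by (rule pow_carrier_mat[OF carr(1)])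
    have "X ^\<^sub>m Suc (Suc k) = (M ^\<^sub>m Suc k - E) * X" using Suc by simp
    also have "\<dots> = M ^\<^sub>m Suc k * X - 0\<^sub>m n n"
      using minus_mult_distrib_mat[OF Mk E carr(2)] by (simp only: EX)
    also have "\<dots> = M ^\<^sub>m Suc k * M - E"
      unfolding X_def mult_minus_distrib_mat[OF Mk carr(1) E] MkE by (rule eq_matI) (use carr(1) E in auto)
    finally show ?case by simp
  qed
  let ?c = "map_mat complex_of_real"
  have Bc: "?c B = of_real (1 - d) \<cdot>\<^sub>m 1\<^sub>m n + of_real a \<cdot>\<^sub>m ?c A"
    and Mc: "?c M = 1 \<cdot>\<^sub>m 1\<^sub>m n + of_real a \<cdot>\<^sub>m ?c A"
    unfolding B_def M_def using A by (auto intro!: eq_matI)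
  have Ac: "?c A \<in> carrier_mat n n" using A by simp
  obtain r where r: "eigenvalue B r" and le_r: "\<And>\<mu>. eigenvalue (?c B) \<mu> \<Longrightarrow> cmod \<mu> \<le> r"
  proof -
    have "0 \<le> B $$ (p, q)" if "p < n" "q < n" for p q
      using that A off_diag[of p q] diag[of p] a by (cases "p = q") (auto simp: B_def)
    then show thesis
      using nonneg_mat_dominant_eigenvalue[OF carr(3)] ij that by blast
  qed
  have r_le: "r \<le> 1 - d"
  proof -
    \<comment> \<open>The dominant eigenvalue \<open>r\<close> is real, so the corresponding
      eigenvalue of \<open>A\<close> equals its real part and the spectral hypothesis bounds
      \<open>r\<close> itself.\<close>
    have "eigenvalue (?c B) (of_real (1 - d) + of_real a * of_real ((r - (1 - d)) / a))"
      using of_real_hom.eigenvalue_hom[OF carr(3) r, where 'a = complex] a by (simp add: field_simps)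
    then have "eigenvalue (?c A) (of_real ((r - (1 - d)) / a))"
      unfolding Bc using a by (subst (asm) eigenvalue_affine_iff[OF Ac]) auto
    from spec[OF this] show ?thesis using a by (simp add: field_simps)
  qed
  have "cmod \<mu> < 1" if ev: "eigenvalue (?c X) \<mu>" for \<mu>
  proof (rule ccontr)
    assume ge: "\<not> cmod \<mu> < 1"
    obtain v where v: "v \<in> carrier_vec n" "v \<noteq> 0\<^sub>v n" "?c X *\<^sub>v v = \<mu> \<cdot>\<^sub>v v"
      using ev carrier_matD[OF carr(2)] unfolding eigenvalue_def eigenvector_def by auto
    have cc: "?c E \<in> carrier_mat n n" "?c H \<in> carrier_mat n n" "?c X \<in> carrier_mat n n" "?c M \<in> carrier_mat n n"
      using E H carr by simp_all
    have "\<mu> \<cdot>\<^sub>v (?c E *\<^sub>v v) = ?c E *\<^sub>v (?c X *\<^sub>v v)" using v cc by (simp add: mult_mat_vec)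
    also have "\<dots> = ?c (E * X) *\<^sub>v v"
      using of_real_hom.mat_hom_mult[OF E carr(2), where 'a = complex] assoc_mult_mat_vec[OF cc(1) cc(3) v(1)] by simp
    also have "\<dots> = 0\<^sub>v n" unfolding EX using v(1) by (intro eq_vecI) (auto simp: scalar_prod_def)
    finally have Ev: "?c E *\<^sub>v v = 0\<^sub>v n"
    proof -
      assume eq: "\<mu> \<cdot>\<^sub>v (?c E *\<^sub>v v) = 0\<^sub>v n"
      have "\<mu> \<noteq> 0" using ge by auto
      show ?thesis
      proof (rule eq_vecI)
        fix p assume "p < dim_vec (0\<^sub>v n :: complex vec)"
        then show "(?c E *\<^sub>v v) $ p = 0\<^sub>v n $ p"
          using arg_cong[OF eq, of "\<lambda>y. y $ p"] \<open>\<mu> \<noteq> 0\<close> cc(1) by (simp del: index_mult_mat_vec)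
      qed (use cc in simp)
    qed
    have "?c M = ?c X + ?c E" unfolding X_def using carr E by (auto intro!: eq_matI)
    then have "?c M *\<^sub>v v = \<mu> \<cdot>\<^sub>v v"
      using cc v by (simp add: add_mult_distrib_mat_vec[of _ n n] Ev)
    then have "eigenvector (?c M) v \<mu>" using v cc by (simp add: eigenvector_def)
    then have "eigenvector (?c M) v (1 + of_real a * ((\<mu> - 1) / of_real a))" using a by simp
    then have evA: "eigenvector (?c A) v ((\<mu> - 1) / of_real a)"
      unfolding Mc using a by (subst (asm) eigenvector_affine_iff[OF Ac]) auto
    then have "eigenvalue (?c B) (of_real (1 - d) + of_real a * ((\<mu> - 1) / of_real a))"
      unfolding Bc using a by (subst eigenvalue_affine_iff[OF Ac]) (auto simp: eigenvalue_def)
    then have "eigenvalue (?c B) (\<mu> - of_real d)" using a by simp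
    then have "\<mu> = 1"
      using le_r[of "\<mu> - of_real d"] r_le ge d by (intro unit_circle_tangent[of d]) auto
    then have Av: "?c A *\<^sub>v v = 0\<^sub>v n"
      using evA v(1) by (auto simp: eigenvector_def intro!: eq_vecI)
    have "v - ?c E *\<^sub>v v = ?c (1\<^sub>m n - E) *\<^sub>v v"
    proof -
      have "?c (1\<^sub>m n - E) = 1\<^sub>m n - ?c E" using E by (auto intro!: eq_matI)
      then show ?thesis using v(1) cc(1) by (simp add: minus_mult_distrib_mat_vec[of _ n n])
    qed
    also have "\<dots> = ?c H *\<^sub>v (?c A *\<^sub>v v)"
      unfolding EH using of_real_hom.mat_hom_mult[OF H A, where 'a = complex] assoc_mult_mat_vec[OF cc(2) Ac v(1)] by simp
    also have "\<dots> = 0\<^sub>v n" unfolding Av using cc(2) by (intro eq_vecI) (auto simp: scalar_prod_def)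
    finally show False using v by (simp add: Ev)
  qed
  then have "(\<lambda>k. (X ^\<^sub>m k) $$ (i, j) / 1 ^ k) \<longlonglongrightarrow> 0"
    by (intro real_pow_entries_tendsto_0[OF carr(2)] ij) auto
  then have "(\<lambda>k. (X ^\<^sub>m Suc k) $$ (i, j)) \<longlonglongrightarrow> 0"
    by (intro LIMSEQ_Suc[of "\<lambda>k. (X ^\<^sub>m k) $$ (i, j)"]) simp
  then have "(\<lambda>k. (X ^\<^sub>m Suc k) $$ (i, j) + E $$ (i, j)) \<longlonglongrightarrow> 0 + E $$ (i, j)"
    by (intro tendsto_add tendsto_const)
  then have "(\<lambda>k. (M ^\<^sub>m Suc k) $$ (i, j)) \<longlonglongrightarrow> E $$ (i, j)"
    unfolding Xk using ij E by simp
  then show ?thesis unfolding M_def[symmetric] by (rule LIMSEQ_imp_Suc)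
qed

text \<open>
  With a nonnegative diagonal, the convergent powers of \<open>I + A\<close> would grow at least like \<open>I + k A\<close>.
\<close>

lemma metzler_ex_negative_diagonal:
  fixes A E H :: "real mat"
  assumes A: "A \<in> carrier_mat n n" and A0: "A \<noteq> 0\<^sub>m n n"
    and off_diag: "\<And>i j. i < n \<Longrightarrow> j < n \<Longrightarrow> i \<noteq> j \<Longrightarrow> 0 \<le> A $$ (i, j)"
    and spec: "\<And>l. eigenvalue (map_mat complex_of_real A) l \<Longrightarrow> Re l \<le> 0"
    and E: "E \<in> carrier_mat n n" and H: "H \<in> carrier_mat n n"
    and AE: "A * E = 0\<^sub>m n n" and EA: "E * A = 0\<^sub>m n n" and EH: "1\<^sub>m n - E = H * A"
  shows "\<exists>i<n. A $$ (i, i) < 0"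
proof (rule ccontr)
  assume "\<not> ?thesis"
  then have nonneg: "0 \<le> A $$ (i, j)" if "i < n" "j < n" for i j
    using that off_diag by (metis linorder_not_less)
  \<comment> \<open>The factor 1 matches \<open>metzler_affine_pow_tendsto\<close> with
    \<open>a = d = 1\<close>, which applies since the diagonal of \<open>A\<close> is now
    nonnegative.\<close>
  define M where "M = 1\<^sub>m n + 1 \<cdot>\<^sub>m A"
  have M: "M \<in> carrier_mat n n" using A by (simp add: M_def)
  obtain p q where pq: "p < n" "q < n" "A $$ (p, q) \<noteq> 0"
    using A A0 by (metis carrier_matD eq_matI index_zero_mat)
  have grow: "(if i = j then 1 else 0) + real k * A $$ (i, j) \<le> (M ^\<^sub>m k) $$ (i, j)"
    if "i < n" "j < n" for i j k
    using that
  proof (induction k arbitrary: i j)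
    case (Suc k)
    have Mk: "M ^\<^sub>m k \<in> carrier_mat n n" by (rule pow_carrier_mat[OF M])
    have diag: "1 \<le> (M ^\<^sub>m k) $$ (i, i)"
      using Suc.IH[of i i] Suc.prems nonneg[of i i] by (simp) (smt (verit) mult_nonneg_nonneg of_nat_0_le_iff)
    have pos: "0 \<le> (M ^\<^sub>m k) $$ (i, l)" if "l < n" for l
      using Suc.IH[of i l] Suc.prems nonneg[of i l] that
      by (smt (verit) mult_nonneg_nonneg of_nat_0_le_iff)
    have "M ^\<^sub>m Suc k = M ^\<^sub>m k + M ^\<^sub>m k * A"
    proof -
      have "1 \<cdot>\<^sub>m A = A" by auto
      then have "M ^\<^sub>m Suc k = M ^\<^sub>m k * (1\<^sub>m n + A)" by (simp add: M_def)
      then show ?thesis using mult_add_distrib_mat[OF Mk one_carrier_mat A] right_mult_one_mat[OF Mk] by simp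
    qed
    then have "(M ^\<^sub>m Suc k) $$ (i, j) = (M ^\<^sub>m k) $$ (i, j) + (\<Sum>l<n. (M ^\<^sub>m k) $$ (i, l) * A $$ (l, j))"
      using Suc.prems A carrier_matD[OF Mk] by (simp add: scalar_prod_def atLeast0LessThan del: pow_mat.simps)
    \<comment> \<open>Only the term \<open>l = i\<close> of the nonnegative sum is kept; its first
      factor is at least 1, which supplies one more copy of \<open>A $$ (i, j)\<close>.\<close>
    moreover have "(M ^\<^sub>m k) $$ (i, i) * A $$ (i, j) \<le> (\<Sum>l<n. (M ^\<^sub>m k) $$ (i, l) * A $$ (l, j))"
      using Suc.prems pos nonneg by (intro member_le_sum[of i "{..<n}" "\<lambda>l. (M ^\<^sub>m k) $$ (i, l) * A $$ (l, j)"]) auto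
    moreover have "1 * A $$ (i, j) \<le> (M ^\<^sub>m k) $$ (i, i) * A $$ (i, j)"
      using diag nonneg Suc.prems by (intro mult_right_mono) auto
    ultimately show ?case using Suc.IH[OF Suc.prems] by (simp add: algebra_simps del: pow_mat.simps)
  qed (use M in simp)
  have "(\<lambda>k. (M ^\<^sub>m k) $$ (p, q)) \<longlonglongrightarrow> E $$ (p, q)"
    unfolding M_def using nonneg pq
    by (intro metzler_affine_pow_tendsto[OF A off_diag spec E H AE EA EH, of 1 1]) auto
  then obtain K where K: "\<And>k. \<bar>(M ^\<^sub>m k) $$ (p, q)\<bar> \<le> K"
    using convergent_imp_Bseq[of "\<lambda>k. (M ^\<^sub>m k) $$ (p, q)"]
    by (auto simp: convergent_def Bseq_def)
  have pos: "0 < A $$ (p, q)" using nonneg[of p q] pq by simp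
  then obtain k where "K < real k * A $$ (p, q)" using reals_Archimedean3 by blast
  then show False using grow[of p q k] K[of k] pq by (auto split: if_splits)
qed

subsection \<open>Norms\<close>

text \<open>Bolzano-Weierstrass, one coordinate at a time: a monotone subsequence in the new
  coordinate is bounded, hence converges, and the earlier limits survive the refinement.\<close>

lemma coordinatewise_convergent_subseq:
  fixes f :: "nat \<Rightarrow> nat \<Rightarrow> real"
  assumes "\<And>m i. i < n \<Longrightarrow> \<bar>f m i\<bar> \<le> c"
  shows "\<exists>r l. strict_mono (r :: nat \<Rightarrow> nat) \<and> (\<forall>i<n. (\<lambda>m. f (r m) i) \<longlonglongrightarrow> l i)"
  using assms
proof (induction n)
  case 0
  show ?case by (auto intro: exI[of _ id] strict_mono_id)
next
  case (Suc n)
  then obtain r l where r: "strict_mono (r :: nat \<Rightarrow> nat)" and l: "\<And>i. i < n \<Longrightarrow> (\<lambda>m. f (r m) i) \<longlonglongrightarrow> l i"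
    by (metis less_Suc_eq)
  obtain g :: "nat \<Rightarrow> nat" where g: "strict_mono g" "monoseq (\<lambda>m. f (r (g m)) n)"
    using seq_monosub[of "\<lambda>m. f (r m) n"] by (auto simp: o_def)
  have "Bseq (\<lambda>m. f (r (g m)) n)"
    by (rule BseqI'[of _ c]) (use Suc.prems in auto)
  then obtain b where b: "(\<lambda>m. f (r (g m)) n) \<longlonglongrightarrow> b"
    using Bseq_monoseq_convergent g(2) by (auto simp: convergent_def)
  have "(\<lambda>m. f (r (g m)) i) \<longlonglongrightarrow> (l(n := b)) i" if "i < Suc n" for i
    using that b LIMSEQ_subseq_LIMSEQ[OF l g(1), of i] by (cases "i = n") (auto simp: o_def)
  moreover have "strict_mono (\<lambda>m. r (g m))" using r g(1) by (simp add: strict_mono_def)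
  ultimately show ?case by (intro exI[of _ "\<lambda>m. r (g m)"] exI[of _ "l(n := b)"]) auto
qed

text \<open>Triangle inequality along the expansion in unit vectors, by induction over truncations
  of \<open>x\<close>. This is the upper half of the comparison with the 1-norm.\<close>

lemma is_vec_norm_le_sum_abs:
  assumes nrm: "is_vec_norm N nrm" and x: "x \<in> carrier_vec N"
  shows "nrm x \<le> (\<Sum>i<N. \<bar>x $ i\<bar> * nrm (unit_vec N i))"
proof -
  have partial: "nrm (vec N (\<lambda>i. if i < k then x $ i else 0)) \<le> (\<Sum>i<k. \<bar>x $ i\<bar> * nrm (unit_vec N i))"
    if "k \<le> N" for k
    using that
  proof (induction k)
    case 0
    have "vec N (\<lambda>i. 0 :: real) = 0\<^sub>v N" by auto
    then have "nrm (vec N (\<lambda>i. 0)) = 0" using nrm by (simp add: is_vec_norm_def)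
    then show ?case by simp
  next
    case (Suc k)
    have "vec N (\<lambda>i. if i < Suc k then x $ i else 0)
        = vec N (\<lambda>i. if i < k then x $ i else 0) + x $ k \<cdot>\<^sub>v unit_vec N k"
      by (rule eq_vecI) (use Suc.prems in \<open>auto simp: unit_vec_def less_Suc_eq\<close>)
    also have "nrm \<dots> \<le> nrm (vec N (\<lambda>i. if i < k then x $ i else 0)) + nrm (x $ k \<cdot>\<^sub>v unit_vec N k)"
      using nrm unfolding is_vec_norm_def by (meson vec_carrier smult_carrier_vec unit_vec_carrier)
    also have "nrm (x $ k \<cdot>\<^sub>v unit_vec N k) = \<bar>x $ k\<bar> * nrm (unit_vec N k)"
      using nrm by (simp add: is_vec_norm_def)
    finally show ?case using Suc by simp
  qed
  have "vec N (\<lambda>i. if i < N then x $ i else 0) = x" using x by auto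
  then show ?thesis using partial[of N] by simp
qed

lemma is_vec_norm_tendsto_0:
  assumes nrm: "is_vec_norm N nrm" and x: "\<And>m. x m \<in> carrier_vec N"
    and lim: "\<And>i. i < N \<Longrightarrow> (\<lambda>m. x m $ i) \<longlonglongrightarrow> 0"
  shows "(\<lambda>m. nrm (x m)) \<longlonglongrightarrow> 0"
proof (rule tendsto_sandwich)
  show "\<forall>\<^sub>F m in sequentially. 0 \<le> nrm (x m)" using nrm x by (simp add: is_vec_norm_def)
  show "\<forall>\<^sub>F m in sequentially. nrm (x m) \<le> (\<Sum>i<N. \<bar>x m $ i\<bar> * nrm (unit_vec N i))"
    using is_vec_norm_le_sum_abs[OF nrm x] by simp
  have "(\<lambda>m. \<Sum>i<N. \<bar>x m $ i\<bar> * nrm (unit_vec N i)) \<longlonglongrightarrow> (\<Sum>i<N. \<bar>0\<bar> * nrm (unit_vec N i))"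
    by (intro tendsto_intros lim) auto
  then show "(\<lambda>m. \<Sum>i<N. \<bar>x m $ i\<bar> * nrm (unit_vec N i)) \<longlonglongrightarrow> 0" by simp
qed simp

text \<open>Lower half of the comparison, by compactness: otherwise vectors of 1-norm 1 have
  \<open>nrm\<close> tending to 0, and the limit of a subsequence would be zero while having 1-norm
  1.\<close>

lemma is_vec_norm_ge_sum_abs:
  assumes nrm: "is_vec_norm N nrm"
  shows "\<exists>c>0. \<forall>x \<in> carrier_vec N. c * (\<Sum>i<N. \<bar>x $ i\<bar>) \<le> nrm x"
proof (rule ccontr)
  assume neg: "\<not> ?thesis"
  have "\<exists>y. y \<in> carrier_vec N \<and> (\<Sum>i<N. \<bar>y $ i\<bar>) = 1 \<and> nrm y \<le> 1 / real (Suc m)" for m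
  proof -
    obtain x where x: "x \<in> carrier_vec N" "nrm x < 1 / real (Suc m) * (\<Sum>i<N. \<bar>x $ i\<bar>)"
      using neg[simplified, rule_format, of "1 / real (Suc m)"] by (auto simp: not_le)
    define s where "s = (\<Sum>i<N. \<bar>x $ i\<bar>)"
    have "0 \<le> nrm x" using nrm x(1) by (simp add: is_vec_norm_def)
    then have "0 < 1 / real (Suc m) * s" using x(2) unfolding s_def by linarith
    then have s: "0 < s" by (simp add: zero_less_divide_iff)
    have "(\<Sum>i<N. \<bar>((1 / s) \<cdot>\<^sub>v x) $ i\<bar>) = 1"
      using x(1) s by (simp add: s_def abs_mult flip: sum_divide_distrib)
    moreover have "nrm ((1 / s) \<cdot>\<^sub>v x) = nrm x / s"
      using nrm x(1) s by (simp add: is_vec_norm_def)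
    moreover have "nrm x / s \<le> 1 / real (Suc m)"
      using x(2) s unfolding s_def[symmetric] by (simp add: field_simps)
    ultimately show ?thesis using x(1) by (intro exI[of _ "(1 / s) \<cdot>\<^sub>v x"]) auto
  qed
  then obtain y where y: "\<And>m. y m \<in> carrier_vec N" and y1: "\<And>m. (\<Sum>i<N. \<bar>y m $ i\<bar>) = 1"
    and ny: "\<And>m. nrm (y m) \<le> 1 / real (Suc m)" by metis
  have "\<bar>y m $ i\<bar> \<le> 1" if "i < N" for m i
    using member_le_sum[of i "{..<N}" "\<lambda>i. \<bar>y m $ i\<bar>"] that y1[of m] by simp
  from coordinatewise_convergent_subseq[of N "\<lambda>m i. y m $ i", OF this]
  obtain r l where r: "strict_mono (r :: nat \<Rightarrow> nat)" and l: "\<And>i. i < N \<Longrightarrow> (\<lambda>m. y (r m) $ i) \<longlonglongrightarrow> l i"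
    by auto
  define z where "z = vec N l"
  have z: "z \<in> carrier_vec N" by (simp add: z_def)
  \<comment> \<open>Coordinatewise convergence passes to \<open>nrm\<close> by the upper half, so
    \<open>nrm z\<close> is at most a null sequence.\<close>
  have "(\<lambda>m. nrm (z - y (r m))) \<longlonglongrightarrow> 0"
  proof (rule is_vec_norm_tendsto_0[OF nrm])
    fix i assume i: "i < N"
    have "(\<lambda>m. l i - y (r m) $ i) \<longlonglongrightarrow> l i - l i" by (intro tendsto_intros l i)
    then show "(\<lambda>m. (z - y (r m)) $ i) \<longlonglongrightarrow> 0" using i carrier_vecD[OF y] by (simp add: z_def)
  qed (use y z in auto)
  moreover have "(\<lambda>m. 1 / real (Suc (r m))) \<longlonglongrightarrow> 0"
    using LIMSEQ_subseq_LIMSEQ[OF LIMSEQ_Suc[OF lim_1_over_n] r] by (simp add: o_def)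
  ultimately have "(\<lambda>m. nrm (z - y (r m)) + 1 / real (Suc (r m))) \<longlonglongrightarrow> 0 + 0" by (rule tendsto_add)
  moreover have "nrm z \<le> nrm (z - y (r m)) + 1 / real (Suc (r m))" for m
  proof -
    have "nrm ((z - y (r m)) + y (r m)) \<le> nrm (z - y (r m)) + nrm (y (r m))"
      using nrm y z by (simp add: is_vec_norm_def)
    moreover have "(z - y (r m)) + y (r m) = z" using y[of "r m"] z by auto
    ultimately show ?thesis using ny[of "r m"] by simp
  qed
  ultimately have "nrm z \<le> 0" using LIMSEQ_le_const[of _ "0 + 0 :: real" "nrm z"] by auto
  moreover have "0 \<le> nrm z" using nrm z by (simp add: is_vec_norm_def)
  ultimately have "z = 0\<^sub>v N" using nrm z by (force simp: is_vec_norm_def)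
  then have "l i = 0" if "i < N" for i
    using that unfolding z_def by (metis index_vec index_zero_vec(1))
  then have "(\<lambda>m. \<Sum>i<N. \<bar>y (r m) $ i\<bar>) \<longlonglongrightarrow> (\<Sum>i<N. \<bar>0\<bar>)"
    using l by (intro tendsto_intros) auto
  then have "(\<lambda>m::nat. 1 :: real) \<longlonglongrightarrow> 0" using y1 by simp
  then show False by (simp add: LIMSEQ_const_iff)
qed

subsection \<open>Stability of the iteration\<close>

text \<open>By \<open>E * A = 0\<close> each row of \<open>E\<close> lies in the kernel of the
  transpose, so it is a linear combination of basis vectors orthogonal to \<open>w\<close>.\<close>

lemma left_annihilator_mult_vec_eq_0:
  fixes A E :: "'a :: field mat"
  assumes A: "A \<in> carrier_mat n n" and E: "E \<in> carrier_mat n n" and EA: "E * A = 0\<^sub>m n n"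
    and basis: "kernel.basis n (transpose_mat A) X"
    and w: "w \<in> carrier_vec n" and orth: "\<And>x. x \<in> X \<Longrightarrow> x \<bullet> w = 0"
  shows "E *\<^sub>v w = 0\<^sub>v n"
proof -
  have At: "transpose_mat A \<in> carrier_mat n n" using A by simp
  interpret K: kernel n n "transpose_mat A" by unfold_locales (rule At)
  have X: "X \<subseteq> mat_kernel (transpose_mat A)" and span: "K.span X = mat_kernel (transpose_mat A)"
    using basis unfolding K.Ker.basis_def by auto
  have Xc: "x \<in> carrier_vec n" if "x \<in> X" for x using that X mat_kernel[OF At] by auto
  have "u \<bullet> w = 0" if u: "u \<in> mat_kernel (transpose_mat A)" for u
  proof -
    have "u \<in> K.span X" using u by (subst span)
    then obtain c U where U: "finite U" "U \<subseteq> X" "u = K.lincomb c U"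
      unfolding K.Ker.span_def by blast
    have "u \<bullet> w = (\<Sum>i<n. u $ i * w $ i)" using w by (simp add: scalar_prod_def atLeast0LessThan)
    also have "\<dots> = (\<Sum>i<n. (\<Sum>x\<in>U. c x * x $ i) * w $ i)"
      using U X by (intro sum.cong refl) (subst U(3), subst K.lincomb_index, auto)
    also have "\<dots> = (\<Sum>i<n. \<Sum>x\<in>U. c x * (x $ i * w $ i))"
      by (simp add: sum_distrib_right mult.assoc)
    also have "\<dots> = (\<Sum>x\<in>U. c x * (\<Sum>i<n. x $ i * w $ i))"
      by (subst sum.swap) (simp add: sum_distrib_left)
    also have "\<dots> = (\<Sum>x\<in>U. c x * (x \<bullet> w))"
      using w by (simp add: scalar_prod_def atLeast0LessThan)
    also have "\<dots> = 0" using orth U(2) by (intro sum.neutral) auto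
    finally show ?thesis .
  qed
  moreover have "row E i \<in> mat_kernel (transpose_mat A)" if i: "i < n" for i
  proof (rule mat_kernelI[OF At])
    show "transpose_mat A *\<^sub>v row E i = 0\<^sub>v n"
    proof (rule eq_vecI)
      fix j assume j: "j < dim_vec (0\<^sub>v n :: 'a vec)"
      have "(transpose_mat A *\<^sub>v row E i) $ j = col A j \<bullet> row E i" using j A by simp
      also have "\<dots> = row E i \<bullet> col A j" using A E by (intro comm_scalar_prod[of _ n]) auto
      also have "\<dots> = (E * A) $$ (i, j)" using i j A E by simp
      finally show "(transpose_mat A *\<^sub>v row E i) $ j = 0\<^sub>v n $ j" using i j by (simp add: EA)
    qed (use A in simp)
  qed (use E in auto)
  ultimately show ?thesis using E by (intro eq_vecI) auto
qed

lemma geco1_map_funpow: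
  assumes A: "A \<in> carrier_mat N N" and y: "y \<in> carrier_vec N"
  shows "(geco1_map A dt ^^ m) y = (1\<^sub>m N + geco1_Phi A dt \<cdot>\<^sub>m A) ^\<^sub>m m *\<^sub>v y"
  using y
proof (induction m arbitrary: y)
  case (Suc m)
  let ?M = "1\<^sub>m N + geco1_Phi A dt \<cdot>\<^sub>m A"
  have M: "?M \<in> carrier_mat N N" using A by simp
  have "(geco1_map A dt ^^ Suc m) y = (geco1_map A dt ^^ m) (?M *\<^sub>v y)"
    using A by (simp add: funpow_swap1 geco1_map_def)
  also have "\<dots> = ?M ^\<^sub>m m *\<^sub>v (?M *\<^sub>v y)"
    using M Suc.prems by (intro Suc.IH) (rule mult_mat_vec_carrier)
  also have "\<dots> = ?M ^\<^sub>m Suc m *\<^sub>v y"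
    using assoc_mult_mat_vec[OF pow_carrier_mat[OF M] M Suc.prems] by simp
  finally show ?case .
qed (use A in simp)

lemma geco1_Phi_pos:
  assumes "0 < mat_trace (destruction_mat A)" "0 < dt"
  shows "0 < geco1_Phi A dt"
  using assms by (simp add: geco1_Phi_def)

lemma mat_trace_destruction_mat:
  assumes "A \<in> carrier_mat N N"
  shows "mat_trace (destruction_mat A) = (\<Sum>i<N. max 0 (- (A $$ (i, i))))"
  using assms by (simp add: mat_trace_def destruction_mat_def mat_diag_def)

text \<open>Each \<open>- (A $$ (i, i))\<close> is at most one summand of the trace, and
  \<open>geco1_Phi\<close> times the trace is 1 minus the exponential. This supplies
  \<open>d\<close>.\<close>

lemma geco1_diagonal_ge:
  assumes A: "A \<in> carrier_mat N N" and pos: "0 < mat_trace (destruction_mat A)" and dt: "0 < dt"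
    and i: "i < N"
  shows "exp (- (dt * mat_trace (destruction_mat A))) \<le> 1 + geco1_Phi A dt * A $$ (i, i)"
proof -
  let ?t = "mat_trace (destruction_mat A)"
  have "- (A $$ (i, i)) \<le> max 0 (- (A $$ (i, i)))" by simp
  also have "\<dots> \<le> ?t"
    unfolding mat_trace_destruction_mat[OF A] by (rule member_le_sum) (use i in auto)
  finally have "geco1_Phi A dt * (- (A $$ (i, i))) \<le> geco1_Phi A dt * ?t"
    using geco1_Phi_pos[OF pos dt] by (intro mult_left_mono) auto
  also have "\<dots> = 1 - exp (- (dt * ?t))"
    using pos by (simp add: geco1_Phi_def)
  finally show ?thesis by simp
qed

theorem theorem5:
  fixes N k :: nat and A :: "real mat" and nv :: "nat \<Rightarrow> real vec"
    and ystar :: "real vec" and nrm :: "real vec \<Rightarrow> real"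
  assumes A_carrier: "A \<in> carrier_mat N N"
    and A_nonzero: "A \<noteq> 0\<^sub>m N N"
    and off_diag: "\<And>i j. i < N \<Longrightarrow> j < N \<Longrightarrow> i \<noteq> j \<Longrightarrow> 0 \<le> A $$ (i, j)"
    and alg: "alg_mult A 0 = k"
    and geom: "geom_mult A 0 = k"
    and k_pos: "1 \<le> k"
    and spec: "spectrum (map_mat complex_of_real A) \<subseteq> {z. Re z \<le> 0}"
    and nv_inj: "inj_on nv {1..k}"
    and nv_basis: "kernel.basis N (transpose_mat A) (nv ` {1..k})"
    and norm: "is_vec_norm N nrm"
    and steady: "ystar \<in> mat_kernel A"
  shows "(\<forall>dt>0. lyapunov_stable_fixed_point N nrm (geco1_map A dt) ystar) \<and>
         (\<exists>\<delta>>0. \<forall>dt>0. \<forall>y0 \<in> carrier_vec N.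
            (\<forall>j\<in>{1..k}. nv j \<bullet> y0 = nv j \<bullet> ystar) \<and> nrm (y0 - ystar) < \<delta> \<longrightarrow>
            (\<lambda>n. nrm ((geco1_map A dt ^^ n) y0 - ystar)) \<longlonglongrightarrow> 0)"
proof -
  note A = A_carrier
  have re: "Re l \<le> 0" if "eigenvalue (map_mat complex_of_real A) l" for l
    using spec that by (auto simp: spectrum_def)
  have "char_matrix A 0 = A" using A by (auto simp: char_matrix_def intro!: eq_matI)
  then have "Polynomial.order 0 (char_poly A) = kernel_dim A"
    using alg geom by (simp add: alg_mult_def geom_mult_def)
  then obtain E H where E: "E \<in> carrier_mat N N" and H: "H \<in> carrier_mat N N"
    and AE: "A * E = 0\<^sub>m N N" and EA: "E * A = 0\<^sub>m N N" and EH: "1\<^sub>m N - E = H * A"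
    using ex_left_right_null_projection[OF A] by blast
  \<comment> \<open>A negative diagonal entry makes the trace positive, so \<open>geco1_Phi\<close>
    has a nonzero denominator.\<close>
  obtain p where p: "p < N" "A $$ (p, p) < 0"
    using metzler_ex_negative_diagonal[OF A A_nonzero off_diag re E H AE EA EH] by blast
  have "0 < max 0 (- (A $$ (p, p)))" using p by simp
  also have "\<dots> \<le> mat_trace (destruction_mat A)"
    unfolding mat_trace_destruction_mat[OF A] by (rule member_le_sum) (use p in auto)
  finally have trace: "0 < mat_trace (destruction_mat A)" .
  define M where "M dt = 1\<^sub>m N + geco1_Phi A dt \<cdot>\<^sub>m A" for dt
  have M: "M dt \<in> carrier_mat N N" for dt using A by (simp add: M_def)
  note Mm = pow_carrier_mat[OF M]
  have lim: "(\<lambda>m. (M dt ^\<^sub>m m) $$ (i, j)) \<longlonglongrightarrow> E $$ (i, j)" if "0 < dt" "i < N" "j < N" for dt i j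
    unfolding M_def
    by (rule metzler_affine_pow_tendsto[where d = "exp (- (dt * mat_trace (destruction_mat A)))",
          OF A off_diag re E H AE EA EH])
       (use geco1_Phi_pos[OF trace that(1)] geco1_diagonal_ge[OF A trace that(1)] that(2,3) in auto)
  have ys: "ystar \<in> carrier_vec N" "A *\<^sub>v ystar = 0\<^sub>v N"
    using mat_kernelD[OF A steady] by auto
  have "c \<cdot>\<^sub>v 0\<^sub>v N = (0\<^sub>v N :: real vec)" for c by auto
  then have Mys: "M dt *\<^sub>v ystar = ystar" for dt
    using A ys by (simp add: M_def add_mult_distrib_mat_vec[of _ N N] smult_mat_vec[of _ N N])
  have Mmys: "M dt ^\<^sub>m m *\<^sub>v ystar = ystar" for dt m
  proof (induction m)
    case (Suc m)
    then show ?case using assoc_mult_mat_vec[OF Mm M ys(1), of dt m dt] by (simp add: Mys)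
  qed (use carrier_matD[OF M] ys in simp)
  \<comment> \<open>As \<open>ystar\<close> is fixed by \<open>M dt\<close>, the error evolves
    linearly; both claims reduce to the powers of \<open>M dt\<close>.\<close>
  have iter: "(geco1_map A dt ^^ m) y0 - ystar = M dt ^\<^sub>m m *\<^sub>v (y0 - ystar)"
    if "y0 \<in> carrier_vec N" for dt m y0
    using mult_minus_distrib_mat_vec[OF Mm that ys(1), of dt m] geco1_map_funpow[OF A that]
    by (simp add: Mmys flip: M_def)
  have coord: "(P *\<^sub>v w) $ i = (\<Sum>j<N. P $$ (i, j) * w $ j)"
    if "P \<in> carrier_mat N N" "w \<in> carrier_vec N" "i < N" for P :: "real mat" and w i
    using that by (simp add: scalar_prod_def atLeast0LessThan)
  obtain c where c: "0 < c" and c_le: "\<And>x. x \<in> carrier_vec N \<Longrightarrow> c * (\<Sum>i<N. \<bar>x $ i\<bar>) \<le> nrm x"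
    using is_vec_norm_ge_sum_abs[OF norm] by blast
  have "lyapunov_stable_fixed_point N nrm (geco1_map A dt) ystar" if dt: "0 < dt" for dt
  proof -
    have "\<exists>b. \<forall>m. \<bar>(M dt ^\<^sub>m m) $$ (i, j)\<bar> \<le> b" if "i < N" "j < N" for i j
      using convergent_imp_Bseq[of "\<lambda>m. (M dt ^\<^sub>m m) $$ (i, j)"] lim[OF dt that]
      by (auto simp: convergent_def Bseq_def)
    then obtain b where b: "\<And>i j m. i < N \<Longrightarrow> j < N \<Longrightarrow> \<bar>(M dt ^\<^sub>m m) $$ (i, j)\<bar> \<le> b i j"
      by metis
    define K where "K = (\<Sum>i<N. \<Sum>j<N. b i j)"
    have b0: "0 \<le> b i j" if "i < N" "j < N" for i j
      using b[OF that, of 0] by (rule order_trans[OF abs_ge_zero])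
    have bK: "b i j \<le> K" if "i < N" "j < N" for i j
    proof -
      have "b i j \<le> (\<Sum>j<N. b i j)" using that b0 by (intro member_le_sum) auto
      also have "\<dots> \<le> K" unfolding K_def using that b0
        by (intro member_le_sum[of i "{..<N}" "\<lambda>i. \<Sum>j<N. b i j"]) (auto intro: sum_nonneg)
      finally show ?thesis .
    qed
    \<comment> \<open>Each coordinate of a power applied to \<open>w\<close> is at most
      \<open>K\<close> times the 1-norm of \<open>w\<close>, hence at most
      \<open>K / c * nrm w\<close>; summing against the norms of the unit vectors gives the
      Lipschitz constant \<open>L\<close>.\<close>
    define L where "L = K / c * (\<Sum>i<N. nrm (unit_vec N i))"
    have nrm0: "0 \<le> nrm x" if "x \<in> carrier_vec N" for x
      using norm that by (simp add: is_vec_norm_def)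
    have "0 \<le> K" unfolding K_def using b0 by (auto intro!: sum_nonneg)
    then have L0: "0 \<le> L" unfolding L_def using c nrm0
      by (intro mult_nonneg_nonneg sum_nonneg divide_nonneg_nonneg) auto
    have lip: "nrm (M dt ^\<^sub>m m *\<^sub>v w) \<le> L * nrm w" if w: "w \<in> carrier_vec N" for m w
    proof -
      have coord_le: "\<bar>(M dt ^\<^sub>m m *\<^sub>v w) $ i\<bar> \<le> K / c * nrm w" if i: "i < N" for i
      proof -
        have "\<bar>(M dt ^\<^sub>m m *\<^sub>v w) $ i\<bar> \<le> (\<Sum>j<N. \<bar>(M dt ^\<^sub>m m) $$ (i, j) * w $ j\<bar>)"
          unfolding coord[OF Mm w i] by (rule sum_abs)
        also have "\<dots> \<le> (\<Sum>j<N. K * \<bar>w $ j\<bar>)"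
          unfolding abs_mult using order_trans[OF b bK] i by (intro sum_mono mult_right_mono) auto
        also have "\<dots> = K / c * (c * (\<Sum>j<N. \<bar>w $ j\<bar>))" using c by (simp add: sum_distrib_left)
        also have "\<dots> \<le> K / c * nrm w" using c_le[OF w] c \<open>0 \<le> K\<close> by (intro mult_left_mono) auto
        finally show ?thesis .
      qed
      have "nrm (M dt ^\<^sub>m m *\<^sub>v w) \<le> (\<Sum>i<N. \<bar>(M dt ^\<^sub>m m *\<^sub>v w) $ i\<bar> * nrm (unit_vec N i))"
        by (rule is_vec_norm_le_sum_abs[OF norm mult_mat_vec_carrier[OF Mm w]])
      also have "\<dots> \<le> (\<Sum>i<N. K / c * nrm w * nrm (unit_vec N i))"
        using coord_le nrm0 by (intro sum_mono mult_right_mono) auto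
      also have "\<dots> = L * nrm w" by (simp add: L_def sum_distrib_left sum_distrib_right ac_simps)
      finally show ?thesis .
    qed
    have "\<exists>\<delta>>0. \<forall>y0 \<in> carrier_vec N. nrm (y0 - ystar) < \<delta> \<longrightarrow>
        (\<forall>m. nrm ((geco1_map A dt ^^ m) y0 - ystar) < \<epsilon>)" if \<epsilon>: "0 < \<epsilon>" for \<epsilon>
    \<comment> \<open>Only \<open>L >= 0\<close> is known, so the 1 added to \<open>L\<close> keeps
      the denominator positive.\<close>
    proof (intro exI[of _ "\<epsilon> / (L + 1)"] conjI ballI impI allI)
      fix y0 m assume y0: "y0 \<in> carrier_vec N" and close: "nrm (y0 - ystar) < \<epsilon> / (L + 1)"
      have w: "y0 - ystar \<in> carrier_vec N" using y0 ys by simp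
      have "nrm ((geco1_map A dt ^^ m) y0 - ystar) \<le> L * nrm (y0 - ystar)"
        unfolding iter[OF y0] by (rule lip[OF w])
      also have "\<dots> \<le> (L + 1) * nrm (y0 - ystar)" using nrm0[OF w] by (simp add: algebra_simps)
      also have "\<dots> < \<epsilon>" using close L0 by (simp add: field_simps)
      finally show "nrm ((geco1_map A dt ^^ m) y0 - ystar) < \<epsilon>" .
    qed (use \<epsilon> L0 in simp)
    moreover have "geco1_map A dt ystar = ystar"
      using Mys[of dt] A by (simp add: geco1_map_def M_def)
    ultimately show ?thesis using ys by (simp add: lyapunov_stable_fixed_point_def)
  qed
  moreover have "(\<lambda>n. nrm ((geco1_map A dt ^^ n) y0 - ystar)) \<longlonglongrightarrow> 0"
    if dt: "0 < dt" and y0: "y0 \<in> carrier_vec N" and eq: "\<forall>j\<in>{1..k}. nv j \<bullet> y0 = nv j \<bullet> ystar" for dt y0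
  proof -
    have w: "y0 - ystar \<in> carrier_vec N" using y0 ys by simp
    have At: "transpose_mat A \<in> carrier_mat N N" using A by simp
    interpret K: kernel N N "transpose_mat A" by unfold_locales (rule At)
    have "nv ` {1..k} \<subseteq> mat_kernel (transpose_mat A)"
      using nv_basis unfolding K.Ker.basis_def by blast
    then have nv: "nv j \<in> carrier_vec N" if "j \<in> {1..k}" for j
      using that mat_kernelD(1)[OF At] by blast
    \<comment> \<open>Equal values of the linear invariants make the initial error orthogonal to the
      kernel of the transpose, so its limit under the powers of \<open>M dt\<close> is 0.\<close>
    have Ew: "E *\<^sub>v (y0 - ystar) = 0\<^sub>v N"
      using eq nv y0 ys
      by (intro left_annihilator_mult_vec_eq_0[OF A E EA nv_basis w])
         (auto simp: scalar_prod_minus_distrib[of _ N])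
    show ?thesis
      unfolding iter[OF y0]
    proof (rule is_vec_norm_tendsto_0[OF norm])
      fix i assume i: "i < N"
      have "(\<lambda>n. \<Sum>j<N. (M dt ^\<^sub>m n) $$ (i, j) * (y0 - ystar) $ j)
          \<longlonglongrightarrow> (\<Sum>j<N. E $$ (i, j) * (y0 - ystar) $ j)"
        using i by (intro tendsto_intros lim dt) auto
      then show "(\<lambda>n. (M dt ^\<^sub>m n *\<^sub>v (y0 - ystar)) $ i) \<longlonglongrightarrow> 0"
        unfolding coord[OF Mm w i] coord[OF E w i, symmetric] Ew using i by simp
    qed (rule mult_mat_vec_carrier[OF Mm w])
  qed
  \<comment> \<open>The limit was obtained for initial values at every distance from
    \<open>ystar\<close>, so the witness 1 serves all \<open>dt\<close> at once.\<close>
  ultimately show ?thesis by (intro conjI exI[of _ 1]) auto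
qed

end
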